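(* Let $T$ and $G$ be arbitrary (finite) graphs. Then $$\widetilde\chi(\mathrm{Hom}(T,G))=\sum_{\emptyset\ne S\subseteq V(T)}(-1)^{|S|+1}\,\widetilde\chi(\mathrm{Hom}_+(T[S],G)).$$
   Context: Graphs are finite, undirected, without multiple edges; loops are allowed. $T[S]$ is the subgraph of $T$ induced by $S$. $\mathrm{Hom}(T,G)$ is the subcomplex of $\prod_{x\in V(T)}\Delta^{V(G)}$ consisting of all cells $\prod_{x\in V(T)}\sigma_x$, with each $\sigma_x$ a nonempty subset of $V(G)$, such that whenever $(x,y)\in E(T)$ one has $\sigma_x\times\sigma_y\subseteq E(G)$. $\mathrm{Hom}_+(T,G)$ is the simplicial subcomplex of the join $\ast_{x\in V(T)}\Delta^{V(G)}$ consisting of all simplices $\ast_{x\in V(T)}\sigma_x$ (with each $\sigma_x\subseteq V(G)$ possibly empty) such that whenever $(x,y)\in E(T)$ and both $\sigma_x,\sigma_y$ are nonempty, one has $\sigma_x\times\sigma_y\subseteq E(G)$. $\widetilde\chi=\chi-1$ denotes the reduced Euler characteristic, so $\widetilde\chi(\emptyset)=-1$. *)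

theory Defs
  imports "Graph_Theory.Graph_Theory" "HOL-Library.FuncSet"
begin

text \<open>
  Graphs are symmetric digraphs \<open>(V, E)\<close> with \<open>E \<subseteq> V \<times> V\<close>, as in the locale
  \<open>pair_pseudo_graph\<close>: finite, symmetric, without parallel arcs, loops allowed.
  The complexes are defined for \<open>pre_digraph\<close>, since the induced subgraph
  \<open>T \<restriction> S\<close> is one; \<open>arcs_ends\<close> is the edge relation.
\<close>

text \<open>
  A finite polyhedral complex enters only through its nonempty cells and their dimensions.
\<close>

record 'c cell_complex =
  cells :: "'c set"
  cell_dim :: "'c \<Rightarrow> nat"

definition euler_char :: "'c cell_complex \<Rightarrow> int" where
  "euler_char K = (\<Sum>c\<in>cells K. (-1) ^ cell_dim K c)"

definition reduced_euler_char :: "'c cell_complex \<Rightarrow> int" where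
  "reduced_euler_char K = euler_char K - 1"

text \<open>
  The cell \<open>\<Prod>\<^sub>x \<sigma>\<^sub>x\<close> of the product of simplices is encoded by the family \<open>\<sigma>\<close> of
  nonempty vertex sets itself, taken extensional so that each cell is counted once. Its
  dimension is the sum of the dimensions of the factors. If \<open>T\<close> has no vertices, the
  empty product is a single point.
\<close>

definition Hom_complex ::
  "('a, 'e) pre_digraph \<Rightarrow> ('b, 'f) pre_digraph \<Rightarrow> ('a \<Rightarrow> 'b set) cell_complex" where
  "Hom_complex T G = \<lparr>
     cells = {\<sigma> \<in> verts T \<rightarrow>\<^sub>E (Pow (verts G) - {{}}).
                \<forall>(x, y) \<in> arcs_ends T. \<sigma> x \<times> \<sigma> y \<subseteq> arcs_ends G},
     cell_dim = (\<lambda>\<sigma>. \<Sum>x\<in>verts T. (card (\<sigma> x) - 1))\<rparr>"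

text \<open>
  The join of copies of the simplex on \<open>V(G)\<close>, one for each vertex \<open>x\<close> of \<open>T\<close>, has vertex
  set \<open>V(T) \<times> V(G)\<close>; the simplex \<open>\<ast>\<^sub>x \<sigma>\<^sub>x\<close> is the disjoint union of the sets \<open>{x} \<times> \<sigma>\<^sub>x\<close>.
  The family with all \<open>\<sigma>\<^sub>x\<close> empty gives the empty simplex, which is not a cell
  of the complex.
\<close>

definition Hom_plus_simplices ::
  "('a, 'e) pre_digraph \<Rightarrow> ('b, 'f) pre_digraph \<Rightarrow> ('a \<times> 'b) set set" where
  "Hom_plus_simplices T G = {Sigma (verts T) \<sigma> | \<sigma>.
     (\<forall>x \<in> verts T. \<sigma> x \<subseteq> verts G) \<and>
     (\<forall>(x, y) \<in> arcs_ends T. \<sigma> x \<noteq> {} \<and> \<sigma> y \<noteq> {} \<longrightarrow> \<sigma> x \<times> \<sigma> y \<subseteq> arcs_ends G)}"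

definition Hom_plus_complex ::
  "('a, 'e) pre_digraph \<Rightarrow> ('b, 'f) pre_digraph \<Rightarrow> ('a \<times> 'b) set cell_complex" where
  "Hom_plus_complex T G = \<lparr>
     cells = Hom_plus_simplices T G - {{}},
     cell_dim = (\<lambda>s. card s - 1)\<rparr>"

end

theory Submission
  imports Defs
begin

text \<open>
  Up to the sign \<open>-1\<close>, the reduced Euler characteristic of \<open>Hom\<^sub>+\<close> is the sum of
  \<open>(-1) ^ |s|\<close> over all its simplices \<open>s\<close>, the empty one included. The simplices of
  \<open>Hom\<^sub>+(T[S], G)\<close> are the simplices \<open>s\<close> of \<open>Hom\<^sub>+(T, G)\<close> whose support, the projection
  to \<open>V(T)\<close>, lies in \<open>S\<close>. After exchanging the sums, the alternating sum over
  the sets \<open>S\<close> between the support of \<open>s\<close> and \<open>V(T)\<close> vanishes unless \<open>s\<close> has full support,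
  and the simplices of full support correspond to the cells of \<open>Hom(T, G)\<close>.
\<close>

text \<open>If \<open>U\<close> is a proper subset of \<open>V\<close>, toggling a fixed element of
  \<open>V - U\<close> pairs the even sets of the interval with the odd ones; the equality of the
  two counts is \<open>card_subsupersets_even_odd\<close>.\<close>

lemma sum_alternating_supersets:
  assumes "finite V" "U \<subseteq> V"
  shows "(\<Sum>S \<in> {S. U \<subseteq> S \<and> S \<subseteq> V}. (-1) ^ card S) = (if U = V then (-1) ^ card V else (0::int))"
proof (cases "U = V")
  case True
  then have "{S. U \<subseteq> S \<and> S \<subseteq> V} = {V}" by auto
  then show ?thesis using True by simp
next
  case False
  let ?I = "{S. U \<subseteq> S \<and> S \<subseteq> V}"
  have "finite ?I"
    by (rule finite_subset[of _ "Pow V"]) (use assms(1) in auto)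
  moreover have "{S. S \<in> ?I \<and> even (card S)} = {S. S \<subseteq> V \<and> U \<subseteq> S \<and> even (card S)}"
    "{S. S \<in> ?I \<and> odd (card S)} = {S. S \<subseteq> V \<and> U \<subseteq> S \<and> odd (card S)}"
    by auto
  then have "card {S. S \<in> ?I \<and> even (card S)} = card {S. S \<in> ?I \<and> odd (card S)}"
    using card_subsupersets_even_odd[of V U] assms False by auto
  ultimately show ?thesis
    using False by (simp only: sum_alternating_cancels if_False)
qed

text \<open>The dimension of a nonempty simplex is one less than its cardinality, which flips the
  sign, and the \<open>-1\<close> in \<open>reduced_euler_char\<close> is the flipped term of the
  empty simplex. Simplices must be finite so that \<open>card s - 1\<close> is a true
  predecessor.\<close>

lemma reduced_euler_char_Hom_plus:
  assumes "finite (Hom_plus_simplices T G)" "\<forall>s \<in> Hom_plus_simplices T G. finite s"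
  shows "reduced_euler_char (Hom_plus_complex T G) = - (\<Sum>s \<in> Hom_plus_simplices T G. (-1) ^ card s)"
proof -
  have empty: "{} \<in> Hom_plus_simplices T G"
    unfolding Hom_plus_simplices_def by (auto intro!: exI[of _ "\<lambda>_. {}"])
  have "(-1) ^ (card s - 1) = - ((-1::int) ^ card s)" if "s \<in> Hom_plus_simplices T G - {{}}" for s
  proof -
    have "card s \<noteq> 0" using that assms(2) by simp
    then obtain n where "card s = Suc n" using not0_implies_Suc by blast
    then show ?thesis by simp
  qed
  then have "euler_char (Hom_plus_complex T G)
      = - (\<Sum>s \<in> Hom_plus_simplices T G - {{}}. (-1) ^ card s)"
    by (simp add: euler_char_def Hom_plus_complex_def sum_negf)
  then show ?thesis
    using sum.remove[OF assms(1) empty, of "\<lambda>s. (-1::int) ^ card s"]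
    by (simp add: reduced_euler_char_def)
qed

lemma Hom_plus_simplices_iff:
  assumes "arcs_ends T \<subseteq> verts T \<times> verts T"
  shows "s \<in> Hom_plus_simplices T G \<longleftrightarrow> s \<subseteq> verts T \<times> verts G \<and>
    (\<forall>x a y b. (x, a) \<in> s \<longrightarrow> (y, b) \<in> s \<longrightarrow> (x, y) \<in> arcs_ends T \<longrightarrow> (a, b) \<in> arcs_ends G)"
    (is "_ \<longleftrightarrow> ?R")
proof
  assume "s \<in> Hom_plus_simplices T G"
  then show ?R unfolding Hom_plus_simplices_def by fast
next
  assume R: ?R
  then have "s = Sigma (verts T) (\<lambda>x. s `` {x})" by auto
  moreover have "\<forall>(x, y) \<in> arcs_ends T. s `` {x} \<times> s `` {y} \<subseteq> arcs_ends G"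
    using R by auto
  moreover have "\<forall>x \<in> verts T. s `` {x} \<subseteq> verts G" using R by auto
  ultimately show "s \<in> Hom_plus_simplices T G"
    unfolding Hom_plus_simplices_def by blast
qed

lemma arcs_ends_induce_subgraph:
  "arcs_ends (T \<restriction> S) = arcs_ends T \<inter> S \<times> S"
  by (auto simp: arcs_ends_conv)

text \<open>The arc condition only tests pairs of vertices in the support of \<open>s\<close>, so
  arcs leaving \<open>S\<close> are irrelevant once the support lies in \<open>S\<close>.\<close>

lemma Hom_plus_simplices_induce_subgraph:
  assumes "arcs_ends T \<subseteq> verts T \<times> verts T" "S \<subseteq> verts T"
  shows "Hom_plus_simplices (T \<restriction> S) G = {s \<in> Hom_plus_simplices T G. fst ` s \<subseteq> S}"
proof -
  have sub: "arcs_ends (T \<restriction> S) \<subseteq> verts (T \<restriction> S) \<times> verts (T \<restriction> S)"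
    by (auto simp: arcs_ends_induce_subgraph)
  have "s \<in> Hom_plus_simplices (T \<restriction> S) G \<longleftrightarrow> s \<in> Hom_plus_simplices T G" if s: "fst ` s \<subseteq> S" for s
  proof -
    have "s \<subseteq> S \<times> verts G \<longleftrightarrow> s \<subseteq> verts T \<times> verts G"
      using s assms(2) by force
    moreover have "x \<in> S" if "(x, a) \<in> s" for x a
      using s that by force
    ultimately show ?thesis
      unfolding Hom_plus_simplices_iff[OF assms(1)] Hom_plus_simplices_iff[OF sub]
        induce_subgraph_verts arcs_ends_induce_subgraph by blast
  qed
  moreover have "fst ` s \<subseteq> S" if "s \<in> Hom_plus_simplices (T \<restriction> S) G" for s
    using that unfolding Hom_plus_simplices_iff[OF sub] induce_subgraph_verts by auto
  ultimately show ?thesis by blast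
qed

text \<open>The inverse sends \<open>s\<close> to its slices, and full support says exactly that
  every slice is nonempty. Restricting to \<open>verts T\<close> gives the extensional
  representative. If \<open>T\<close> has no vertices, the empty simplex corresponds to the single
  point.\<close>

lemma bij_betw_Hom_cells_full_support:
  assumes "arcs_ends T \<subseteq> verts T \<times> verts T"
  shows "bij_betw (Sigma (verts T)) (cells (Hom_complex T G))
    {s \<in> Hom_plus_simplices T G. fst ` s = verts T}"
proof (rule bij_betw_byWitness[where f' = "\<lambda>s. \<lambda>x \<in> verts T. s `` {x}"])
  show "\<forall>\<sigma> \<in> cells (Hom_complex T G). (\<lambda>x \<in> verts T. Sigma (verts T) \<sigma> `` {x}) = \<sigma>"
    by (auto simp: Hom_complex_def fun_eq_iff PiE_def extensional_def)
  show "\<forall>s \<in> {s \<in> Hom_plus_simplices T G. fst ` s = verts T}.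
      Sigma (verts T) (\<lambda>x \<in> verts T. s `` {x}) = s"
    using assms by (auto simp: Hom_plus_simplices_iff)
  show "Sigma (verts T) ` cells (Hom_complex T G)
      \<subseteq> {s \<in> Hom_plus_simplices T G. fst ` s = verts T}"
  proof (rule image_subsetI, rule CollectI, rule conjI)
    fix \<sigma> assume "\<sigma> \<in> cells (Hom_complex T G)"
    then have \<sigma>: "\<forall>x \<in> verts T. \<sigma> x \<subseteq> verts G" "\<forall>x \<in> verts T. \<sigma> x \<noteq> {}"
      "\<forall>(x, y) \<in> arcs_ends T. \<sigma> x \<times> \<sigma> y \<subseteq> arcs_ends G"
      by (auto simp: Hom_complex_def PiE_def Pi_def)
    show "Sigma (verts T) \<sigma> \<in> Hom_plus_simplices T G"
      unfolding Hom_plus_simplices_iff[OF assms] using \<sigma>(1,3) by auto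
    show "fst ` Sigma (verts T) \<sigma> = verts T"
      using \<sigma>(2) by (auto simp: fst_image_Sigma)
  qed
  show "(\<lambda>s. \<lambda>x \<in> verts T. s `` {x}) ` {s \<in> Hom_plus_simplices T G. fst ` s = verts T}
      \<subseteq> cells (Hom_complex T G)"
  proof (rule image_subsetI)
    fix s assume s: "s \<in> {s \<in> Hom_plus_simplices T G. fst ` s = verts T}"
    then have R: "s \<subseteq> verts T \<times> verts G"
      "\<forall>x a y b. (x, a) \<in> s \<longrightarrow> (y, b) \<in> s \<longrightarrow> (x, y) \<in> arcs_ends T \<longrightarrow> (a, b) \<in> arcs_ends G"
      by (simp_all add: Hom_plus_simplices_iff[OF assms])
    have "s `` {x} \<in> Pow (verts G) - {{}}" if "x \<in> verts T" for x
    proof -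
      have "x \<in> fst ` s" using s that by simp
      then show ?thesis using R(1) by auto
    qed
    moreover have "\<forall>(x, y) \<in> arcs_ends T. (\<lambda>x \<in> verts T. s `` {x}) x \<times> (\<lambda>x \<in> verts T. s `` {x}) y \<subseteq> arcs_ends G"
    proof (intro ballI, clarify)
      fix x y a b
      assume e: "(x, y) \<in> arcs_ends T"
        and a: "a \<in> (\<lambda>x \<in> verts T. s `` {x}) x" and b: "b \<in> (\<lambda>x \<in> verts T. s `` {x}) y"
      \<comment> \<open>Outside \<open>verts T\<close> the restricted family is
        \<open>undefined\<close>; only at vertices are its values slices of
        \<open>s\<close>.\<close>
      have "x \<in> verts T" "y \<in> verts T" using assms e by auto
      then show "(a, b) \<in> arcs_ends G" using R(2) e a b by auto
    qed
    ultimately show "(\<lambda>x \<in> verts T. s `` {x}) \<in> cells (Hom_complex T G)"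
      unfolding Hom_complex_def cell_complex.simps mem_Collect_eq restrict_PiE_iff by blast
  qed
qed

text \<open>Each factor of a cell has dimension one less than its cardinality, so the dimension of
  the cell falls short of the cardinality of its simplex by \<open>card (verts T)\<close>. As a sign
  is its own inverse, this shift appears as a factor.\<close>

lemma euler_char_Hom:
  assumes "arcs_ends T \<subseteq> verts T \<times> verts T" "finite (verts T)" "finite (verts G)"
  shows "euler_char (Hom_complex T G)
    = (\<Sum>s \<in> {s \<in> Hom_plus_simplices T G. fst ` s = verts T}. (-1) ^ card s * (-1) ^ card (verts T))"
proof -
  have "(-1) ^ cell_dim (Hom_complex T G) \<sigma>
      = (-1::int) ^ card (Sigma (verts T) \<sigma>) * (-1) ^ card (verts T)"
    if "\<sigma> \<in> cells (Hom_complex T G)" for \<sigma>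
  proof -
    have \<sigma>: "finite (\<sigma> x)" "card (\<sigma> x) > 0" if "x \<in> verts T" for x
    proof -
      have "\<sigma> x \<subseteq> verts G" "\<sigma> x \<noteq> {}"
        using \<open>\<sigma> \<in> _\<close> that by (auto simp: Hom_complex_def PiE_def Pi_def)
      then show "finite (\<sigma> x)" "card (\<sigma> x) > 0"
        using assms(3) finite_subset by (auto simp: card_gt_0_iff)
    qed
    \<comment> \<open>The truncated subtraction is harmless since every \<open>\<sigma> x\<close> is
      finite and nonempty.\<close>
    have "card (Sigma (verts T) \<sigma>) = (\<Sum>x\<in>verts T. (card (\<sigma> x) - 1) + 1)"
      using \<sigma> assms(2) by (simp add: card_SigmaI cong: sum.cong)
    also have "\<dots> = cell_dim (Hom_complex T G) \<sigma> + card (verts T)"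
      unfolding sum.distrib by (simp add: Hom_complex_def)
    finally show ?thesis
      by (simp add: power_add flip: power_mult_distrib)
  qed
  then show ?thesis
    unfolding euler_char_def
    by (simp add: sum.reindex_bij_betw[OF bij_betw_Hom_cells_full_support[OF assms(1)], symmetric])
qed

lemma reduced_euler_char_Hom:
  assumes "arcs_ends T \<subseteq> verts T \<times> verts T" "finite (verts T)" "finite (verts G)"
  shows "reduced_euler_char (Hom_complex T G) =
    (\<Sum>S \<in> Pow (verts T) - {{}}.
       (-1) ^ (card S + 1) * reduced_euler_char (Hom_plus_complex (T \<restriction> S) G))"
proof -
  let ?V = "verts T" and ?A = "Hom_plus_simplices T G"
  \<comment> \<open>The summand for \<open>S\<close>: the extra sign in
    \<open>(-1) ^ (card S + 1)\<close> cancels the minus sign of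
    \<open>reduced_euler_char_Hom_plus\<close>.\<close>
  let ?f = "\<lambda>S. (-1) ^ card S * (\<Sum>s \<in> {s \<in> ?A. fst ` s \<subseteq> S}. (-1::int) ^ card s)"
  have sub: "s \<subseteq> ?V \<times> verts G" if "s \<in> ?A" for s
    using that Hom_plus_simplices_iff[OF assms(1)] by blast
  have fin_V: "finite (?V \<times> verts G)" using assms by blast
  have fin_A: "finite ?A"
    by (rule finite_subset[of _ "Pow (?V \<times> verts G)"]) (use sub fin_V in auto)
  have fin_s: "finite s" if "s \<in> ?A" for s
    using sub[OF that] fin_V finite_subset by blast
  have supp: "fst ` s \<subseteq> ?V" if "s \<in> ?A" for s
    using sub[OF that] by auto
  have "(-1) ^ (card S + 1) * reduced_euler_char (Hom_plus_complex (T \<restriction> S) G) = ?f S"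
    if "S \<subseteq> ?V" for S
    using fin_A fin_s Hom_plus_simplices_induce_subgraph[OF assms(1) that, of G]
    by (simp add: reduced_euler_char_Hom_plus)
  then have rhs: "(\<Sum>S \<in> Pow ?V - {{}}.
       (-1) ^ (card S + 1) * reduced_euler_char (Hom_plus_complex (T \<restriction> S) G))
     = (\<Sum>S \<in> Pow ?V - {{}}. ?f S)"
    by (intro sum.cong) auto
  \<comment> \<open>Only the empty simplex has empty support, so the missing term at
    \<open>S = {}\<close> would be 1. Completing the sum to all of \<open>Pow ?V\<close> costs this
    1, which becomes the \<open>-1\<close> in the reduced Euler characteristic of
    \<open>Hom_complex T G\<close>.\<close>
  have "{s \<in> ?A. fst ` s \<subseteq> {}} = {{}}"
    using Hom_plus_simplices_iff[OF assms(1), of "{}" G] by auto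
  then have "?f {} = 1" by simp
  then have "(\<Sum>S \<in> Pow ?V - {{}}. ?f S) = (\<Sum>S \<in> Pow ?V. ?f S) - 1"
    using sum.remove[of "Pow ?V" "{}" ?f] assms(2) by simp
  also have "(\<Sum>S \<in> Pow ?V. ?f S)
      = (\<Sum>S \<in> Pow ?V. \<Sum>s \<in> {s \<in> ?A. fst ` s \<subseteq> S}. (-1) ^ card s * (-1) ^ card S)"
    by (simp add: sum_distrib_left mult.commute)
  also have "\<dots> = (\<Sum>s \<in> ?A. \<Sum>S \<in> {S \<in> Pow ?V. fst ` s \<subseteq> S}. (-1) ^ card s * (-1) ^ card S)"
    using assms(2) fin_A by (intro sum.swap_restrict) auto
  also have "\<dots> = (\<Sum>s \<in> ?A. if fst ` s = ?V then (-1) ^ card s * (-1) ^ card ?V else 0)"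
  proof (rule sum.cong)
    fix s assume "s \<in> ?A"
    have "{S \<in> Pow ?V. fst ` s \<subseteq> S} = {S. fst ` s \<subseteq> S \<and> S \<subseteq> ?V}" by auto
    then show "(\<Sum>S \<in> {S \<in> Pow ?V. fst ` s \<subseteq> S}. (-1) ^ card s * (-1) ^ card S)
        = (if fst ` s = ?V then (-1) ^ card s * (-1) ^ card ?V else (0::int))"
      using sum_alternating_supersets[OF assms(2) supp[OF \<open>s \<in> ?A\<close>]]
      by (simp flip: sum_distrib_left)
  qed simp
  also have "\<dots> = euler_char (Hom_complex T G)"
    using assms fin_A by (simp add: euler_char_Hom sum.inter_filter)
  finally show ?thesis
    unfolding rhs by (simp add: reduced_euler_char_def)
qed

theorem theorem6p1:
  fixes T :: "'a pair_pre_digraph" and G :: "'b pair_pre_digraph"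
  assumes "pair_pseudo_graph T" and "pair_pseudo_graph G"
  shows "reduced_euler_char (Hom_complex (with_proj T) (with_proj G)) =
    (\<Sum>S \<in> Pow (pverts T) - {{}}.
       (-1) ^ (card S + 1) *
       reduced_euler_char (Hom_plus_complex (with_proj T \<restriction> S) (with_proj G)))"
proof -
  have "pair_fin_digraph T" "pair_wf_digraph T" "pair_fin_digraph G"
    using assms by (auto simp: pair_pseudo_graph_def pair_fin_digraph_def)
  \<comment> \<open>Under \<open>with_proj\<close> the arcs are pairs with the projections as
    endpoints, so \<open>arcs_ends\<close> is the arc set itself.\<close>
  then have "arcs_ends (with_proj T) \<subseteq> verts (with_proj T) \<times> verts (with_proj T)"
    "finite (verts (with_proj T))" "finite (verts (with_proj G))"
    by (auto dest: pair_wf_digraph.wellformed' pair_fin_digraph.pair_finite_verts)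
  from reduced_euler_char_Hom[OF this] show ?thesis
    by simp
qed

end
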